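(* Let $f,g:\mathbb{R}^d\to\mathbb{R}$ be differentiable, convex and $G$-Lipschitz ($G>0$), and let $w^\ast$ be a solution of $\min_{w\in\mathbb{R}^d} f(w)$ subject to $g(w)\le 0$. Let $T\ge 1$ be an integer, $w_1\in\mathbb{R}^d$, $D:=\|w_1-w^\ast\|$, and let the iterates be generated by $$w_{t+1}=\arg\min_{w\in\mathbb{R}^d}\ h_t(w)+\frac{1}{2\eta}\|w-w_t\|^2,\qquad h_t(w)=\sigma_\beta(g(w_t)-\epsilon)\,g(w)+[1-\sigma_\beta(g(w_t)-\epsilon)]\,f(w),$$ where $\sigma_\beta(x)=\min\{1,\max\{0,1+\beta x\}\}$. Define $$\mathcal{A}=\{t\in\{1,\dots,T\} : g(w_t)<\epsilon\},\qquad \bar w=\sum_{t\in\mathcal{A}}\alpha_t w_t,\qquad \alpha_t=\frac{1-\sigma_\beta(g(w_t)-\epsilon)}{\sum_{s\in\mathcal{A}}[1-\sigma_\beta(g(w_s)-\epsilon)]}.$$ If $$\epsilon=\frac{2\sqrt{2}\,DG}{\sqrt{T}},\qquad \eta=\frac{D}{G\sqrt{2T}},\qquad \beta=\frac{2}{\epsilon},$$ then $\mathcal{A}$ is nonempty, $\bar w$ is well-defined, and $\bar w$ is an $\epsilon$-solution, i.e. $f(\bar w)-f(w^\ast)\le\epsilon$ and $g(\bar w)\le\epsilon$.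
   Context: $\|\cdot\|$ is the Euclidean norm. The tolerance satisfies $\epsilon>0$ (so $\beta=2/\epsilon$ is defined and $\eta>0$). A function $f$ is $G$-Lipschitz if $|f(x)-f(y)|\le G\|x-y\|$ for all $x,y$ (for differentiable $f$, equivalently $\|\nabla f(x)\|\le G$ for all $x$). *)

theory Defs
  imports "HOL-Analysis.Analysis"
begin

definition soft_switch :: "real \<Rightarrow> real \<Rightarrow> real" where
  "soft_switch \<beta> x = min 1 (max 0 (1 + \<beta> * x))"

(* The surrogate h_t is the instance with u = w t. *)
definition switched_objective ::
  "('a \<Rightarrow> real) \<Rightarrow> ('a \<Rightarrow> real) \<Rightarrow> real \<Rightarrow> real \<Rightarrow> 'a \<Rightarrow> 'a \<Rightarrow> real" where
  "switched_objective f g \<beta> \<epsilon> u v =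
     soft_switch \<beta> (g u - \<epsilon>) * g v + (1 - soft_switch \<beta> (g u - \<epsilon>)) * f v"

(* As a relation; the step is single-valued for convex f, g and \<eta> > 0,
   because the proximal objective is then strongly convex. *)
definition prox_switching_step ::
  "('a::real_normed_vector \<Rightarrow> real) \<Rightarrow> ('a \<Rightarrow> real) \<Rightarrow> real \<Rightarrow> real \<Rightarrow> real \<Rightarrow> 'a \<Rightarrow> 'a \<Rightarrow> bool" where
  "prox_switching_step f g \<beta> \<epsilon> \<eta> u u' \<longleftrightarrow>
     is_arg_min (\<lambda>v. switched_objective f g \<beta> \<epsilon> u v + 1 / (2 * \<eta>) * (norm (v - u))\<^sup>2) (\<lambda>_. True) u'"

definition near_feasible_indices :: "('a \<Rightarrow> real) \<Rightarrow> real \<Rightarrow> (nat \<Rightarrow> 'a) \<Rightarrow> nat \<Rightarrow> nat set" where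
  "near_feasible_indices g \<epsilon> w T = {t \<in> {1..T}. g (w t) < \<epsilon>}"

definition total_weight :: "('a \<Rightarrow> real) \<Rightarrow> real \<Rightarrow> real \<Rightarrow> (nat \<Rightarrow> 'a) \<Rightarrow> nat \<Rightarrow> real" where
  "total_weight g \<beta> \<epsilon> w T =
     (\<Sum>s\<in>near_feasible_indices g \<epsilon> w T. 1 - soft_switch \<beta> (g (w s) - \<epsilon>))"

(* Meaningful only when total_weight is nonzero, since x / 0 = 0. *)
definition averaging_weight :: "('a \<Rightarrow> real) \<Rightarrow> real \<Rightarrow> real \<Rightarrow> (nat \<Rightarrow> 'a) \<Rightarrow> nat \<Rightarrow> nat \<Rightarrow> real" where
  "averaging_weight g \<beta> \<epsilon> w T t =
     (1 - soft_switch \<beta> (g (w t) - \<epsilon>)) / total_weight g \<beta> \<epsilon> w T"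

definition averaged_iterate ::
  "('a::real_vector \<Rightarrow> real) \<Rightarrow> real \<Rightarrow> real \<Rightarrow> (nat \<Rightarrow> 'a) \<Rightarrow> nat \<Rightarrow> 'a" where
  "averaged_iterate g \<beta> \<epsilon> w T =
     (\<Sum>t\<in>near_feasible_indices g \<epsilon> w T. averaging_weight g \<beta> \<epsilon> w T t *\<^sub>R w t)"

definition eps_solution ::
  "('a \<Rightarrow> real) \<Rightarrow> ('a \<Rightarrow> real) \<Rightarrow> 'a \<Rightarrow> real \<Rightarrow> 'a \<Rightarrow> bool" where
  "eps_solution f g wstar \<epsilon> v \<longleftrightarrow> f v - f wstar \<le> \<epsilon> \<and> g v \<le> \<epsilon>"

end

theory Submission
  imports Defs
begin

text \<open>
  Each proximal step satisfies the usual three-point inequality, which together with the Lipschitz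
  bound gives \<open>h\<^sub>t(w\<^sub>t) - h\<^sub>t(w\<^sup>*) \<le> \<eta>G\<^sup>2/2 + (\<parallel>w\<^sub>t - w\<^sup>*\<parallel>\<^sup>2 - \<parallel>w\<^sub>t\<^sub>+\<^sub>1 - w\<^sup>*\<parallel>\<^sup>2)/(2\<eta>)\<close>.
  Summing, the total regret is at most \<open>D\<^sup>2/(2\<eta>) + T\<eta>G\<^sup>2/2 = (3/8)\<epsilon>T\<close>. Writing \<open>\<sigma>\<^sub>t\<close> for the
  switching weights, \<open>\<sigma>\<^sub>t > 0\<close> forces \<open>g(w\<^sub>t) > \<epsilon>/2\<close>, hence with \<open>S = \<Sum>(1 - \<sigma>\<^sub>t)\<close>
  \<open>\<epsilon>(T - S)/2 + \<Sum>(1 - \<sigma>\<^sub>t)(f(w\<^sub>t) - f(w\<^sup>*)) \<le> (3/8)\<epsilon>T\<close>,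
  which rules out \<open>S = 0\<close> and bounds the averaged optimality gap by \<open>\<epsilon>/2\<close>.
\<close>

text \<open>Strong convexity of the squared norm in exact form; the \<open>s * (1 - s)\<close> term
  is the source of the gain in the three-point inequality.\<close>

lemma norm_convex_combination_squared:
  fixes x y :: "'a::real_inner"
  shows "(norm (x + s *\<^sub>R (y - x)))\<^sup>2 =
    (1 - s) * (norm x)\<^sup>2 + s * (norm y)\<^sup>2 - s * (1 - s) * (norm (y - x))\<^sup>2"
  unfolding power2_norm_eq_inner
  by (simp add: inner_simps inner_commute algebra_simps)

text \<open>Compare the minimizer \<open>u'\<close> with the points of the segment towards
  \<open>v\<close>. Convexity of \<open>h\<close> and the exact expansion of the squared norm leave
  a common factor \<open>s\<close>; divide by it and let \<open>s\<close> tend to 0 from the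
  right.\<close>

lemma prox_three_point:
  fixes h :: "'a::real_inner \<Rightarrow> real"
  assumes "convex_on UNIV h"
    and min: "is_arg_min (\<lambda>v. h v + q * (norm (v - u))\<^sup>2) (\<lambda>_. True) u'"
  shows "h u' + q * (norm (u' - u))\<^sup>2 + q * (norm (v - u'))\<^sup>2 \<le> h v + q * (norm (v - u))\<^sup>2"
proof -
  let ?d = "(norm (v - u'))\<^sup>2"
  let ?L = "h u' + q * (norm (u' - u))\<^sup>2" and ?R = "h v + q * (norm (v - u))\<^sup>2"
  have le: "?L + q * (1 - s) * ?d \<le> ?R" if s: "0 < s" "s < 1" for s
  proof -
    let ?m = "u' + s *\<^sub>R (v - u')"
    have "?m = (1 - s) *\<^sub>R u' + s *\<^sub>R v" by (simp add: algebra_simps)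
    then have h: "h ?m \<le> (1 - s) * h u' + s * h v"
      using convex_onD[OF assms(1), of s u' v] s by simp
    have eq: "?m - u = (u' - u) + s *\<^sub>R ((v - u) - (u' - u))" by simp
    have n: "(norm (?m - u))\<^sup>2 = (1 - s) * (norm (u' - u))\<^sup>2 + s * (norm (v - u))\<^sup>2 - s * (1 - s) * ?d"
      unfolding eq norm_convex_combination_squared by simp
    have "?L \<le> h ?m + q * (norm (?m - u))\<^sup>2"
      using min by (auto simp: is_arg_min_linorder)
    also have "\<dots> \<le> (1 - s) * h u' + s * h v +
        q * ((1 - s) * (norm (u' - u))\<^sup>2 + s * (norm (v - u))\<^sup>2 - s * (1 - s) * ?d)"
      using h unfolding n by simp
    finally have "s * (?L + q * (1 - s) * ?d) \<le> s * ?R"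
      by (simp add: algebra_simps)
    with s show ?thesis by simp
  qed
  have "((\<lambda>s. ?L + q * (1 - s) * ?d) \<longlongrightarrow> ?L + q * (1 - 0) * ?d) (at_right 0)"
    by (intro tendsto_intros)
  moreover have "eventually (\<lambda>s. ?L + q * (1 - s) * ?d \<le> ?R) (at_right 0)"
    using le by (auto simp: eventually_at_right_field intro!: exI[of _ 1])
  ultimately have "?L + q * (1 - 0) * ?d \<le> ?R"
    by (rule tendsto_upperbound) simp
  then show ?thesis by simp
qed

text \<open>Young's inequality, scaled so that its quadratic term matches the proximal
  penalty.\<close>

lemma linear_le_quadratic:
  fixes G n \<eta> :: real
  assumes "\<eta> > 0"
  shows "G * n \<le> \<eta> * G\<^sup>2 / 2 + 1 / (2 * \<eta>) * n\<^sup>2"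
proof -
  have "0 \<le> (n - \<eta> * G)\<^sup>2 / (2 * \<eta>)" using assms by simp
  also have "\<dots> = \<eta> * G\<^sup>2 / 2 + 1 / (2 * \<eta>) * n\<^sup>2 - G * n"
    using assms by (simp add: field_simps power2_eq_square)
  finally show ?thesis by simp
qed

lemma prox_step_regret:
  fixes h :: "'a::real_inner \<Rightarrow> real"
  assumes "convex_on UNIV h" and lip: "G-lipschitz_on UNIV h" and "\<eta> > 0"
    and "is_arg_min (\<lambda>v. h v + 1 / (2 * \<eta>) * (norm (v - u))\<^sup>2) (\<lambda>_. True) u'"
  shows "h u - h v \<le> 1 / (2 * \<eta>) * (norm (u - v))\<^sup>2 - 1 / (2 * \<eta>) * (norm (u' - v))\<^sup>2 + \<eta> * G\<^sup>2 / 2"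
proof -
  have "h u - h u' \<le> G * norm (u' - u)"
    using lipschitz_onD[OF lip, of u u'] by (simp add: dist_real_def dist_norm norm_minus_commute)
  with prox_three_point[OF assms(1,4), of v] linear_le_quadratic[OF \<open>\<eta> > 0\<close>, of G "norm (u' - u)"]
  show ?thesis by (simp add: norm_minus_commute)
qed

text \<open>The index \<open>T\<close> has a bound of its own because \<open>T\<close> iterates are
  linked by only \<open>T - 1\<close> steps, so there is no \<open>a (T + 1)\<close> to telescope
  with.\<close>

lemma sum_le_telescope:
  fixes r a :: "nat \<Rightarrow> real"
  assumes "T \<ge> 1" and step: "\<And>t. 1 \<le> t \<Longrightarrow> t < T \<Longrightarrow> r t \<le> a t - a (t + 1) + c"
    and last: "r T \<le> a T + c"
  shows "(\<Sum>t\<in>{1..T}. r t) \<le> a 1 + T * c"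
proof -
  have "1 \<le> n \<Longrightarrow> n \<le> T \<Longrightarrow> (\<Sum>t\<in>{1..<n}. r t) \<le> a 1 - a n + (real n - 1) * c" for n
  proof (induction n rule: nat_induct_at_least)
    case (Suc n)
    then show ?case using step[of n] by (simp add: algebra_simps)
  qed simp
  from this[of T] have "(\<Sum>t\<in>{1..<T}. r t) \<le> a 1 - a T + (real T - 1) * c"
    using assms(1) by simp
  moreover have "(\<Sum>t\<in>{1..T}. r t) = (\<Sum>t\<in>{1..<T}. r t) + r T"
    using assms(1) sum.last_plus[of 1 T r] by simp
  ultimately show ?thesis using last by (simp add: algebra_simps)
qed

lemma soft_switch_bounds: "0 \<le> soft_switch \<beta> x" "soft_switch \<beta> x \<le> 1"
  by (auto simp: soft_switch_def)

lemma soft_switch_less_1_iff: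
  assumes "\<beta> > 0"
  shows "soft_switch \<beta> x < 1 \<longleftrightarrow> x < 0"
  using assms by (auto simp: soft_switch_def min_less_iff_disj mult_less_0_iff)

text \<open>The switch vanishes below \<open>- 1 / \<beta>\<close>, so multiplying by it discards
  exactly the arguments for which the bound could fail.\<close>

lemma soft_switch_mult_ge:
  assumes "\<beta> > 0"
  shows "soft_switch \<beta> x * (- 1 / \<beta>) \<le> soft_switch \<beta> x * x"
proof (cases "x \<ge> - 1 / \<beta>")
  case True
  then show ?thesis by (intro mult_left_mono soft_switch_bounds)
next
  case False
  then have "soft_switch \<beta> x = 0"
    using assms by (simp add: soft_switch_def field_simps)
  then show ?thesis by simp
qed

lemma convex_on_switched_objective:
  assumes "convex_on UNIV f" "convex_on UNIV g"
  shows "convex_on UNIV (switched_objective f g \<beta> \<epsilon> u)"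
  unfolding switched_objective_def[abs_def]
  by (intro convex_on_add convex_on_cmul assms) (simp_all add: soft_switch_bounds)

text \<open>The two weights are nonnegative with sum 1, so the constant stays \<open>G\<close>
  instead of growing to \<open>2 * G\<close>.\<close>

lemma lipschitz_on_switched_objective:
  fixes f g :: "'a::metric_space \<Rightarrow> real"
  assumes "G-lipschitz_on UNIV f" "G-lipschitz_on UNIV g"
  shows "G-lipschitz_on UNIV (switched_objective f g \<beta> \<epsilon> u)"
proof -
  let ?s = "soft_switch \<beta> (g u - \<epsilon>)"
  have "(\<bar>?s\<bar> * G + \<bar>1 - ?s\<bar> * G)-lipschitz_on UNIV (switched_objective f g \<beta> \<epsilon> u)"
    unfolding switched_objective_def[abs_def]
    by (intro lipschitz_on_add lipschitz_on_cmult_real assms)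
  moreover have "\<bar>?s\<bar> * G + \<bar>1 - ?s\<bar> * G = G"
    using soft_switch_bounds[of \<beta> "g u - \<epsilon>"] by (simp add: algebra_simps)
  ultimately show ?thesis by simp
qed

lemma prox_switching_regret:
  fixes w :: "nat \<Rightarrow> 'a::real_inner"
  assumes cf: "convex_on UNIV f" and cg: "convex_on UNIV g"
    and lf: "G-lipschitz_on UNIV f" and lg: "G-lipschitz_on UNIV g"
    and "T \<ge> 1" and "\<eta> > 0"
    and step: "\<And>t. 1 \<le> t \<Longrightarrow> t < T \<Longrightarrow> prox_switching_step f g \<beta> \<epsilon> \<eta> (w t) (w (t + 1))"
  shows "(\<Sum>t\<in>{1..T}. switched_objective f g \<beta> \<epsilon> (w t) (w t) - switched_objective f g \<beta> \<epsilon> (w t) v)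
    \<le> 1 / (2 * \<eta>) * (norm (w 1 - v))\<^sup>2 + T * (\<eta> * G\<^sup>2 / 2)"
proof (rule sum_le_telescope[where a = "\<lambda>t. 1 / (2 * \<eta>) * (norm (w t - v))\<^sup>2"])
  fix t assume "1 \<le> t" "t < T"
  from step[OF this] show "switched_objective f g \<beta> \<epsilon> (w t) (w t) - switched_objective f g \<beta> \<epsilon> (w t) v
    \<le> 1 / (2 * \<eta>) * (norm (w t - v))\<^sup>2 - 1 / (2 * \<eta>) * (norm (w (t + 1) - v))\<^sup>2 + \<eta> * G\<^sup>2 / 2"
    unfolding prox_switching_step_def
    by (intro prox_step_regret convex_on_switched_objective lipschitz_on_switched_objective assms)
next
  \<comment> \<open>There is no step after the last iterate; the Lipschitz bound alone suffices there.\<close>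
  have "switched_objective f g \<beta> \<epsilon> (w T) (w T) - switched_objective f g \<beta> \<epsilon> (w T) v \<le> G * norm (w T - v)"
    using lipschitz_onD[OF lipschitz_on_switched_objective[OF lf lg], of "w T" v]
    by (simp add: dist_real_def dist_norm abs_le_iff)
  with linear_le_quadratic[OF \<open>\<eta> > 0\<close>, of G "norm (w T - v)"]
  show "switched_objective f g \<beta> \<epsilon> (w T) (w T) - switched_objective f g \<beta> \<epsilon> (w T) v
    \<le> 1 / (2 * \<eta>) * (norm (w T - v))\<^sup>2 + \<eta> * G\<^sup>2 / 2"
    by simp
qed fact

text \<open>The distance term contributes \<open>\<epsilon> * T / 4\<close> and the Lipschitz term
  \<open>\<epsilon> * T / 8\<close>. What matters later is that the total stays below
  \<open>\<epsilon> * T / 2\<close>.\<close>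

lemma prox_regret_constant:
  fixes G D :: real
  assumes "G > 0" "D > 0" "T \<ge> (1::nat)"
    and "\<epsilon> = 2 * sqrt 2 * D * G / sqrt (real T)" and "\<eta> = D / (G * sqrt (2 * real T))"
  shows "1 / (2 * \<eta>) * D\<^sup>2 + T * (\<eta> * G\<^sup>2 / 2) = 3 / 8 * (\<epsilon> * T)"
proof -
  \<comment> \<open>Naming the two square roots turns the claim into a rational identity modulo
    \<open>q\<^sup>2 = 2\<close>.\<close>
  define r where "r = sqrt (real T)"
  have r: "r > 0" "real T = r\<^sup>2" using assms(3) by (simp_all add: r_def)
  define q where "q = sqrt 2"
  have q: "q > 0" "q\<^sup>2 = 2" by (simp_all add: q_def)
  have e: "\<epsilon> = 2 * q * D * G / r" and h: "\<eta> = D / (G * (q * r))"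
    using assms by (simp_all add: r_def q_def real_sqrt_mult)
  show ?thesis unfolding e h r(2) using assms(1,2) r(1) q
    by (simp add: field_simps power2_eq_square)
qed

text \<open>Jensen's inequality with unnormalized weights, to be applied to both \<open>f\<close>
  and \<open>g\<close>.\<close>

lemma convex_on_weighted_average_le:
  fixes x :: "'i \<Rightarrow> 'a::real_vector"
  assumes "convex_on UNIV f" "finite A" "A \<noteq> {}"
    and c: "\<And>i. i \<in> A \<Longrightarrow> c i \<ge> 0" and S: "sum c A > 0"
    and le: "(\<Sum>i\<in>A. c i * f (x i)) \<le> b * sum c A"
  shows "f (\<Sum>i\<in>A. (c i / sum c A) *\<^sub>R x i) \<le> b"
proof -
  have "f (\<Sum>i\<in>A. (c i / sum c A) *\<^sub>R x i) \<le> (\<Sum>i\<in>A. c i / sum c A * f (x i))"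
    using c S by (intro convex_on_sum[OF assms(2,3,1)])
      (auto simp: sum_divide_distrib[symmetric] less_imp_le)
  also have "\<dots> = (\<Sum>i\<in>A. c i * f (x i)) / sum c A"
    by (simp add: sum_divide_distrib)
  also have "\<dots> \<le> b" using le S by (simp add: divide_le_eq)
  finally show ?thesis .
qed

theorem theorem6:
  fixes f g :: "real ^ 'd \<Rightarrow> real"
    and w :: "nat \<Rightarrow> real ^ 'd"
    and wstar :: "real ^ 'd"
    and G D \<epsilon> \<eta> \<beta> :: real
    and T :: nat
  assumes "\<forall>x. f differentiable (at x)" and "\<forall>x. g differentiable (at x)"
    and "convex_on UNIV f" and "convex_on UNIV g"
    and "G > 0" and "G-lipschitz_on UNIV f" and "G-lipschitz_on UNIV g"
    and "is_arg_min f (\<lambda>v. g v \<le> 0) wstar"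
    and "T \<ge> 1"
    and "D = norm (w 1 - wstar)"
    and "\<And>t. 1 \<le> t \<Longrightarrow> t < T \<Longrightarrow> prox_switching_step f g \<beta> \<epsilon> \<eta> (w t) (w (t + 1))"
    and "\<epsilon> > 0"
    and "\<epsilon> = 2 * sqrt 2 * D * G / sqrt (real T)"
    and "\<eta> = D / (G * sqrt (2 * real T))"
    and "\<beta> = 2 / \<epsilon>"
  shows "near_feasible_indices g \<epsilon> w T \<noteq> {} \<and>
    total_weight g \<beta> \<epsilon> w T \<noteq> 0 \<and>
    eps_solution f g wstar \<epsilon> (averaged_iterate g \<beta> \<epsilon> w T)"
proof -
  note cf = assms(3) and cg = assms(4) and T = \<open>T \<ge> 1\<close> and eps = \<open>\<epsilon> > 0\<close>
  have fin: "finite (near_feasible_indices g \<epsilon> w T)"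
    by (simp add: near_feasible_indices_def)
  \<comment> \<open>Since \<epsilon> is a multiple of \<open>D\<close>, its positivity excludes
    starting at \<open>wstar\<close> and makes the step size positive.\<close>
  have "D \<noteq> 0" using assms(12,13) by auto
  then have D: "D > 0" using assms(10) by simp
  then have \<eta>: "\<eta> > 0" using assms(5,9,14) by simp
  have \<beta>: "\<beta> > 0" using eps assms(15) by simp
  have gstar: "g wstar \<le> 0" using assms(8) by (simp add: is_arg_min_def)
  define A where "A = near_feasible_indices g \<epsilon> w T"
  define \<sigma> where "\<sigma> t = soft_switch \<beta> (g (w t) - \<epsilon>)" for t
  define c where "c t = 1 - \<sigma> t" for t
  define S where "S = sum c A"
  have c0: "c t \<ge> 0" for t using soft_switch_bounds by (simp add: c_def \<sigma>_def)
  \<comment> \<open>Seen as the support of \<open>c\<close>, the set \<open>A\<close> can replace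
    \<open>{1..T}\<close> in every sum weighted by \<open>c\<close>.\<close>
  have A: "A = {t \<in> {1..T}. c t > 0}"
    using soft_switch_less_1_iff[OF \<beta>] by (auto simp: A_def near_feasible_indices_def c_def \<sigma>_def)
  have sum_A: "(\<Sum>t\<in>{1..T}. c t * z t) = (\<Sum>t\<in>A. c t * z t)" for z :: "nat \<Rightarrow> real"
  proof (rule sum.mono_neutral_right)
    show "\<forall>t\<in>{1..T} - A. c t * z t = 0" using c0 by (auto simp: A not_less intro: antisym)
  qed (auto simp: A)
  \<comment> \<open>Here \<open>1 / \<beta> = \<epsilon> / 2\<close>: wherever the constraint
    carries weight, its value is at least \<open>\<epsilon> - \<epsilon> / 2\<close>.\<close>
  have \<sigma>_eps: "\<sigma> t * (\<epsilon> / 2) \<le> \<sigma> t * g (w t)" for t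
    using soft_switch_mult_ge[OF \<beta>, of "g (w t) - \<epsilon>"] eps
    by (simp add: assms(15) \<sigma>_def algebra_simps)
  \<comment> \<open>The first two terms are \<open>\<sigma> t * (\<epsilon> / 2)\<close>, a lower
    bound for the constraint part of the regret because \<open>g wstar \<le> 0\<close>.\<close>
  have "\<epsilon> / 2 - \<epsilon> / 2 * c t + c t * (f (w t) - f wstar)
      \<le> switched_objective f g \<beta> \<epsilon> (w t) (w t) - switched_objective f g \<beta> \<epsilon> (w t) wstar" for t
  proof -
    have "\<sigma> t * g wstar \<le> 0" using gstar soft_switch_bounds by (simp add: \<sigma>_def mult_nonneg_nonpos)
    with \<sigma>_eps[of t] show ?thesis
      by (simp add: switched_objective_def c_def \<sigma>_def[symmetric] field_simps)
  qed
  then have "(\<Sum>t\<in>{1..T}. \<epsilon> / 2 - \<epsilon> / 2 * c t + c t * (f (w t) - f wstar)) \<le>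
      (\<Sum>t\<in>{1..T}. switched_objective f g \<beta> \<epsilon> (w t) (w t) - switched_objective f g \<beta> \<epsilon> (w t) wstar)"
    by (intro sum_mono)
  also have "\<dots> \<le> 3 / 8 * (\<epsilon> * T)"
    using prox_switching_regret[where w = w and v = wstar, OF cf cg assms(6,7) T \<eta> assms(11)]
      prox_regret_constant[OF assms(5) D T assms(13,14)]
    unfolding assms(10)[symmetric] by linarith
  also have "(\<Sum>t\<in>{1..T}. \<epsilon> / 2 - \<epsilon> / 2 * c t + c t * (f (w t) - f wstar)) =
      \<epsilon> * T / 2 - \<epsilon> / 2 * S + (\<Sum>t\<in>A. c t * (f (w t) - f wstar))"
    using sum_A[of "\<lambda>_. 1"] sum_A[of "\<lambda>t. f (w t) - f wstar"]
    by (simp add: sum.distrib sum_subtractf S_def sum_distrib_left[symmetric] sum_divide_distrib[symmetric])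
  finally have main: "\<epsilon> * T / 2 - \<epsilon> / 2 * S + (\<Sum>t\<in>A. c t * (f (w t) - f wstar)) \<le> 3 / 8 * (\<epsilon> * T)" .
  have eT: "\<epsilon> * T > 0" using eps T by simp
  \<comment> \<open>For empty \<open>A\<close>, \<open>main\<close> would read
    \<open>\<epsilon> * T / 2 \<le> 3 / 8 * (\<epsilon> * T)\<close>.\<close>
  have ne: "A \<noteq> {}"
    using main eT by (auto simp: S_def)
  have S: "S > 0"
    unfolding S_def using fin ne by (intro sum_pos) (auto simp: A A_def[symmetric])
  have tw: "total_weight g \<beta> \<epsilon> w T = S"
    by (simp add: total_weight_def S_def A_def c_def \<sigma>_def)
  have avg: "averaged_iterate g \<beta> \<epsilon> w T = (\<Sum>t\<in>A. (c t / sum c A) *\<^sub>R w t)"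
    by (simp add: averaged_iterate_def averaging_weight_def tw A_def[symmetric] c_def \<sigma>_def S_def)
  note average_le = convex_on_weighted_average_le[where c = c and x = w, OF _ fin[folded A_def] ne c0 S[unfolded S_def],
      folded avg]
  have "f (averaged_iterate g \<beta> \<epsilon> w T) \<le> f wstar + \<epsilon> / 2"
  proof (rule average_le[OF cf])
    \<comment> \<open>By \<open>main\<close> this sum is at most
      \<open>\<epsilon> / 2 * S - \<epsilon> * T / 8\<close>, hence below
      \<open>\<epsilon> / 2 * S\<close>.\<close>
    have "(\<Sum>t\<in>A. c t * (f (w t) - f wstar)) = (\<Sum>t\<in>A. c t * f (w t)) - f wstar * sum c A"
      by (simp add: right_diff_distrib sum_subtractf sum_distrib_left mult.commute)
    with main eT show "(\<Sum>t\<in>A. c t * f (w t)) \<le> (f wstar + \<epsilon> / 2) * sum c A"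
      by (simp add: S_def algebra_simps)
  qed
  moreover have "g (averaged_iterate g \<beta> \<epsilon> w T) \<le> \<epsilon>"
  proof (rule average_le[OF cg])
    \<comment> \<open>No regret bound enters here: each averaged iterate satisfies
      \<open>g (w t) < \<epsilon>\<close> by the choice of \<open>A\<close>.\<close>
    have "c t * g (w t) \<le> \<epsilon> * c t" if "t \<in> A" for t
      using that mult_right_mono[OF _ c0[of t], of "g (w t)" \<epsilon>]
      by (simp add: A_def near_feasible_indices_def mult.commute)
    then show "(\<Sum>t\<in>A. c t * g (w t)) \<le> \<epsilon> * sum c A"
      by (simp add: sum_distrib_left sum_mono)
  qed
  ultimately show ?thesis
    using ne S eps by (simp add: eps_solution_def tw A_def)
qed

end
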